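(* Let $r,s\ge 1$ and $t\ge 2$ be integers, and let $\rho\in\mathcal{P}_{r,s}$ be a $t$-core. Let $\mathcal{D}^t_{r,s}(\rho)=\{\lambda\in\mathcal{P}_{r,s}\mid \mathrm{core}_t(\lambda)=\rho\}$. Let $n_i=\left\lfloor\frac{r+s+t-1-i}{t}\right\rfloor$ for $0\le i\le t-1$, and let $a_i=|v^i|$, where $(v^0,\dots,v^{t-1})$ is the $t$-tuple of binary words associated to $\rho$ (as a partition in $\mathcal{P}_{r,s}$). Then the number of partitions in $\mathcal{D}^t_{r,s}(\rho)$ is $$\prod_{i=0}^{t-1}\binom{n_i}{a_i}.$$
   Context: A partition $\lambda=(\lambda_1\ge\lambda_2\ge\cdots)$ is a weakly decreasing finite sequence of positive integers (possibly empty), extended by $\lambda_j=0$ for $j>\ell(\lambda)$, where $\ell(\lambda)$ is the number of parts. $\mathcal{P}_{r,s}$ is the set of partitions with $\ell(\lambda)\le r$ and $\lambda_1\le s$. A rim-hook of $\lambda$ is a connected skew shape $\lambda/\mu$ (with $\mu\subseteq\lambda$ a partition) containing no $2\times2$ block of boxes; a $t$-rim hook is one with exactly $t$ boxes. The $t$-core $\mathrm{core}_t(\lambda)$ is the partition obtained by successively removing $t$-rim hooks until none can be removed (it does not depend on the order of removals); $\lambda$ is a $t$-core if $\mathrm{core}_t(\lambda)=\lambda$. Words associated to a partition $\lambda\in\mathcal{P}_{r,s}$: the balanced abacus of $\lambda$ is the word $w=(w_m)_{m\in\mathbb{Z}}$ in $\{0,1\}$ with $w_m=1$ if $m=\lambda_j-j$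 for some $j\ge1$ and $w_m=0$ otherwise (equivalently, it traces the boundary of $\lambda$ with $1$ for an up step and $0$ for a right step, normalised so that $|\{m\ge0: w_m=1\}|=|\{m<0:w_m=0\}|$). With $n_i=\left\lfloor\frac{r+s+t-1-i}{t}\right\rfloor$, set $$v^i=(w_{-r+i},\,w_{-r+i+t},\,\dots,\,w_{-r+i+t(n_i-1)}),\qquad 0\le i\le t-1.$$ For a binary word $v$, $|v|$ denotes the number of $1$'s in $v$. *)

theory Defs
  imports Complex_Main
begin

(* Parts are indexed from 1, with trailing zeros cut off, so that each partition is represented by
   exactly one list. *)
definition is_partition :: "nat list \<Rightarrow> bool" where
  "is_partition la \<longleftrightarrow> sorted_wrt (\<ge>) la \<and> (\<forall>x \<in> set la. x > 0)"

definition part :: "nat list \<Rightarrow> nat \<Rightarrow> nat" where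
  "part la j = (if 1 \<le> j \<and> j \<le> length la then la ! (j - 1) else 0)"

definition partitions_in_box :: "nat \<Rightarrow> nat \<Rightarrow> nat list set" where
  "partitions_in_box r s = {la. is_partition la \<and> length la \<le> r \<and> part la 1 \<le> s}"

definition young_diagram :: "nat list \<Rightarrow> (nat \<times> nat) set" where
  "young_diagram la = {(i, j). 1 \<le> i \<and> i \<le> length la \<and> 1 \<le> j \<and> j \<le> part la i}"

definition box_adjacent :: "nat \<times> nat \<Rightarrow> nat \<times> nat \<Rightarrow> bool" where
  "box_adjacent b c \<longleftrightarrow>
     (fst b = fst c \<and> (snd c = snd b + 1 \<or> snd b = snd c + 1)) \<or>
     (snd b = snd c \<and> (fst c = fst b + 1 \<or> fst b = fst c + 1))"

definition boxes_connected :: "(nat \<times> nat) set \<Rightarrow> bool" where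
  "boxes_connected S \<longleftrightarrow>
     (\<forall>b \<in> S. \<forall>c \<in> S. (b, c) \<in> {(x, y). x \<in> S \<and> y \<in> S \<and> box_adjacent x y}\<^sup>*)"

definition contains_2x2 :: "(nat \<times> nat) set \<Rightarrow> bool" where
  "contains_2x2 S \<longleftrightarrow> (\<exists>i j. {(i, j), (i + 1, j), (i, j + 1), (i + 1, j + 1)} \<subseteq> S)"

definition removes_rim_hook :: "nat \<Rightarrow> nat list \<Rightarrow> nat list \<Rightarrow> bool" where
  "removes_rim_hook t la mu \<longleftrightarrow>
     is_partition la \<and> is_partition mu \<and> young_diagram mu \<subseteq> young_diagram la \<and>
     boxes_connected (young_diagram la - young_diagram mu) \<and>
     \<not> contains_2x2 (young_diagram la - young_diagram mu) \<and>
     card (young_diagram la - young_diagram mu) = t"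

(* For t > 0 the result of exhaustively removing t-rim hooks exists and is independent of the
   order of removals, so the definite description is proper on partitions. *)
definition t_core_of :: "nat \<Rightarrow> nat list \<Rightarrow> nat list" where
  "t_core_of t la =
     (THE mu. (removes_rim_hook t)\<^sup>*\<^sup>* la mu \<and> (\<nexists>nu. removes_rim_hook t mu nu))"

definition is_t_core :: "nat \<Rightarrow> nat list \<Rightarrow> bool" where
  "is_t_core t la \<longleftrightarrow> t_core_of t la = la"

definition balanced_abacus :: "nat list \<Rightarrow> int \<Rightarrow> nat" where
  "balanced_abacus la m = (if \<exists>j \<ge> 1. m = int (part la j) - int j then 1 else 0)"

(* The subtraction on nat is only used for i < t, where it does not truncate. *)
definition runner_length :: "nat \<Rightarrow> nat \<Rightarrow> nat \<Rightarrow> nat \<Rightarrow> nat" where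
  "runner_length r s t i = (r + s + t - 1 - i) div t"

definition runner_word :: "nat \<Rightarrow> nat \<Rightarrow> nat \<Rightarrow> nat list \<Rightarrow> nat \<Rightarrow> nat list" where
  "runner_word r s t la i =
     map (\<lambda>k. balanced_abacus la (- int r + int i + int t * int k)) [0..<runner_length r s t i]"

definition num_ones :: "nat list \<Rightarrow> nat" where
  "num_ones v = count_list v 1"

definition box_partitions_with_core :: "nat \<Rightarrow> nat \<Rightarrow> nat \<Rightarrow> nat list \<Rightarrow> nat list set" where
  "box_partitions_with_core r s t rho = {la \<in> partitions_in_box r s. t_core_of t la = rho}"

end

(* Encode a partition with at most N parts by its beta set {la_j + N - j : 1 \<le> j \<le> N}, the ones of
   the abacus read from position -N on.  Removing a t-rim hook means replacing some x in this set by
   x - t, where x - t is not in the set.  Such a move preserves the number of elements in each residue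
   class mod t, and a set that admits no move is determined by these numbers, since in each class it
   is an initial segment.  So a partition has core rho iff its residue counts are those of rho, and
   the subsets of {0..<r+s} with prescribed counts are chosen independently in each residue class. *)
theory Submission
  imports Defs "HOL-Library.FuncSet"
begin

section \<open>Partitions as weakly decreasing part functions, and rows of skew diagrams\<close>

section \<open>Partitions and skew diagrams\<close>

lemma part_antimono:
  assumes "is_partition la" "1 \<le> i" "i \<le> j"
  shows "part la j \<le> part la i"
proof (cases "i = j \<or> length la < j")
  case True
  then show ?thesis using assms by (auto simp: part_def)
next
  case False
  then have "sorted_wrt (\<ge>) la" "i - 1 < j - 1" "j - 1 < length la"
    using assms by (auto simp: is_partition_def)
  then have "la ! (i - 1) \<ge> la ! (j - 1)"
    by (simp add: sorted_wrt_iff_nth_less)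
  then show ?thesis using assms False by (auto simp: part_def)
qed

lemma part_pos_iff:
  assumes "is_partition la"
  shows "part la j > 0 \<longleftrightarrow> 1 \<le> j \<and> j \<le> length la"
  using assms by (auto simp: part_def is_partition_def)

text \<open>The length of the list is recovered as the number of indices whose part is
  positive.\<close>

lemma partition_eqI:
  assumes la: "is_partition la" and mu: "is_partition mu" and eq: "\<And>j. part la j = part mu j"
  shows "la = mu"
proof (rule nth_equalityI)
  have "{1..length la} = {j. part la j > 0}"
    by (auto simp: part_pos_iff[OF la])
  also have "\<dots> = {1..length mu}"
    by (auto simp: eq part_pos_iff[OF mu])
  finally have "card {1..length la} = card {1..length mu}" by (rule arg_cong)
  then show len: "length la = length mu" by simp
  fix i assume "i < length la"
  then show "la ! i = mu ! i" using eq[of "Suc i"] len by (simp add: part_def)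
qed

text \<open>Lists carry no trailing zeros, so the induction drops the last index when f vanishes
  there. Otherwise monotonicity makes all N values positive and the full list of values
  works.\<close>

lemma ex_partition:
  assumes "\<And>j. 1 \<le> j \<Longrightarrow> j < N \<Longrightarrow> f (Suc j) \<le> (f j :: nat)"
  shows "\<exists>la. is_partition la \<and> length la \<le> N \<and> (\<forall>j\<in>{1..N}. part la j = f j)"
  using assms
proof (induction N)
  case 0
  have "is_partition []" by (simp add: is_partition_def)
  then show ?case by force
next
  case (Suc N)
  have anti: "f j \<le> f i" if "1 \<le> i" "i \<le> j" "j \<le> Suc N" for i j
    using that(2,3)
  proof (induction j rule: dec_induct)
    case (step n)
    then show ?case using Suc.prems[of n] that(1) by simp
  qed simp
  show ?case
  proof (cases "f (Suc N) = 0")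
    case True
    obtain la where la: "is_partition la" "length la \<le> N" "\<forall>j\<in>{1..N}. part la j = f j"
      using Suc.IH Suc.prems by auto
    then have "part la j = f j" if "j \<in> {1..Suc N}" for j
      using that True by (cases "j = Suc N") (auto simp: part_def)
    then show ?thesis using la by (intro exI[of _ la]) auto
  next
    case False
    define la where "la = map f [1..<Suc (Suc N)]"
    have nth: "la ! i = f (Suc i)" if "i < Suc N" for i
      unfolding la_def using that by (subst nth_map) (auto simp del: upt_Suc)
    have len: "length la = Suc N" by (simp add: la_def)
    have "sorted_wrt (\<ge>) la"
      unfolding sorted_wrt_iff_nth_less len using nth anti by simp
    moreover have "x > 0" if "x \<in> set la" for x
    proof -
      obtain j where "x = f j" "1 \<le> j" "j \<le> Suc N"
        using \<open>x \<in> set la\<close> by (auto simp: la_def simp del: upt_Suc)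
      then show ?thesis using False anti[of j "Suc N"] by simp
    qed
    ultimately have "is_partition la" by (simp add: is_partition_def)
    moreover have "part la j = f j" if "j \<in> {1..Suc N}" for j
      using that by (cases j) (auto simp: part_def len nth)
    ultimately show ?thesis using len by (intro exI[of _ la]) auto
  qed
qed

lemma mem_young_diagram:
  "(i, c) \<in> young_diagram la \<longleftrightarrow> 1 \<le> i \<and> 1 \<le> c \<and> c \<le> part la i"
  by (auto simp: young_diagram_def part_def)

text \<open>The bounds 1 \<le> i and 1 \<le> c are absorbed: \<open>part\<close> is 0 in row 0,
  which leaves that row empty, and a column to the right of \<open>part mu i\<close> is at least
  1.\<close>

lemma mem_skew_diagram:
  "(i, c) \<in> young_diagram la - young_diagram mu \<longleftrightarrow> part mu i < c \<and> c \<le> part la i"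
proof (cases "i = 0")
  case True
  then show ?thesis by (auto simp: mem_young_diagram part_def)
qed (auto simp: mem_young_diagram)

lemma young_diagram_subset_iff:
  "young_diagram mu \<subseteq> young_diagram la \<longleftrightarrow> (\<forall>j. part mu j \<le> part la j)"
proof
  assume sub: "young_diagram mu \<subseteq> young_diagram la"
  show "\<forall>j. part mu j \<le> part la j"
  proof
    fix j
    show "part mu j \<le> part la j"
    proof (cases "part mu j = 0")
      case False
      then have "(j, part mu j) \<in> young_diagram mu"
        by (auto simp: mem_young_diagram) (auto simp: part_def split: if_splits)
      then have "(j, part mu j) \<in> young_diagram la" using sub by blast
      then show ?thesis by (simp add: mem_young_diagram)
    qed simp
  qed
next
  assume "\<forall>j. part mu j \<le> part la j"
  then show "young_diagram mu \<subseteq> young_diagram la"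
    by (auto simp: mem_young_diagram) (meson le_trans)
qed

section \<open>Rim hooks described row by row\<close>

section \<open>Rim hooks\<close>

(* The rim hook occupies rows p, ..., q.  Consecutive rows of a rim hook overlap in exactly one
   column, which forces mu_j = la_(j+1) - 1 above the last row. *)
definition hook_shape :: "nat list \<Rightarrow> nat list \<Rightarrow> nat \<Rightarrow> nat \<Rightarrow> bool" where
  "hook_shape la mu p q \<longleftrightarrow> 1 \<le> p \<and> p \<le> q \<and>
     (\<forall>j. j < p \<or> q < j \<longrightarrow> part mu j = part la j) \<and>
     (\<forall>j. p \<le> j \<and> j < q \<longrightarrow> Suc (part mu j) = part la (Suc j)) \<and>
     part mu q < part la q"

lemma hook_shape_less:
  assumes "is_partition la" "hook_shape la mu p q" "p \<le> j" "j \<le> q"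
  shows "part mu j < part la j"
proof (cases "j = q")
  case True
  then show ?thesis using assms by (simp add: hook_shape_def)
next
  case False
  then have "Suc (part mu j) = part la (Suc j)" "1 \<le> j"
    using assms by (auto simp: hook_shape_def)
  then show ?thesis using part_antimono[OF assms(1), of j "Suc j"] by simp
qed

lemma hook_shape_le:
  assumes "is_partition la" "hook_shape la mu p q"
  shows "part mu j \<le> part la j"
proof (cases "p \<le> j \<and> j \<le> q")
  case True
  then show ?thesis using hook_shape_less[OF assms] by (simp add: less_imp_le)
next
  case False
  then show ?thesis using assms(2) by (auto simp: hook_shape_def not_le)
qed

text \<open>Above row q, row i of the hook has la_i - la_(i+1) + 1 boxes, so the sum telescopes to
  la_p - mu_q + q - p. The additive form avoids truncated subtraction.\<close>

lemma card_hook_shape: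
  assumes la: "is_partition la" and hs: "hook_shape la mu p q"
  shows "card (young_diagram la - young_diagram mu) + part mu q + p = part la p + q"
proof -
  have pq: "p \<le> q" using hs by (simp add: hook_shape_def)
  have "young_diagram la - young_diagram mu = Sigma {p..q} (\<lambda>i. {part mu i<..part la i})"
  proof (rule set_eqI, clarify)
    fix i c
    show "(i, c) \<in> young_diagram la - young_diagram mu \<longleftrightarrow>
        (i, c) \<in> Sigma {p..q} (\<lambda>i. {part mu i<..part la i})"
      using hs unfolding mem_skew_diagram hook_shape_def
      by (cases "p \<le> i \<and> i \<le> q") auto
  qed
  then have "card (young_diagram la - young_diagram mu) = (\<Sum>i\<in>{p..q}. part la i - part mu i)"
    by (simp add: card_SigmaI)
  then have "int (card (young_diagram la - young_diagram mu)) =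
      (\<Sum>i\<in>{p..q}. int (part la i) - int (part mu i))"
    using hook_shape_le[OF la hs] by (simp add: of_nat_diff)
  also have "\<dots> = (\<Sum>i\<in>{p..<q}. int (part la i) - int (part mu i)) + (int (part la q) - int (part mu q))"
    using pq by (simp add: sum.last_plus add.commute flip: atLeastLessThanSuc_atLeastAtMost)
  also have "(\<Sum>i\<in>{p..<q}. int (part la i) - int (part mu i)) =
      (\<Sum>i\<in>{p..<q}. (- int (part la (Suc i)) + int (Suc i)) - (- int (part la i) + int i))"
  proof (rule sum.cong)
    fix i assume "i \<in> {p..<q}"
    then have "Suc (part mu i) = part la (Suc i)" using hs by (simp add: hook_shape_def)
    then have "int (part la (Suc i)) = int (part mu i) + 1" by linarith
    then show "int (part la i) - int (part mu i) =
        (- int (part la (Suc i)) + int (Suc i)) - (- int (part la i) + int i)" by simp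
  qed simp
  also have "\<dots> = (- int (part la q) + int q) - (- int (part la p) + int p)"
    using pq by (rule sum_Suc_diff')
  finally show ?thesis by linarith
qed

text \<open>Rows j and j+1 of the skew diagram share the columns mu_j + 1, ..., la_(j+1).
  Connectedness forces at least one shared column, and the absence of a 2x2 block at most
  one.\<close>

lemma removes_rim_hook_imp_hook_shape:
  assumes "t \<ge> 1" and rem: "removes_rim_hook t la mu"
  shows "\<exists>p q. hook_shape la mu p q \<and> part la p + q = part mu q + p + t"
proof -
  define D where "D = young_diagram la - young_diagram mu"
  have la: "is_partition la" and mu: "is_partition mu"
    and le: "\<And>j. part mu j \<le> part la j" and conn: "boxes_connected D"
    and no22: "\<not> contains_2x2 D" and card: "card D = t"
    using rem unfolding removes_rim_hook_def D_def[symmetric] young_diagram_subset_iff by auto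
  have memD: "(i, c) \<in> D \<longleftrightarrow> part mu i < c \<and> c \<le> part la i" for i c
    unfolding D_def mem_skew_diagram ..
  define R where "R = {j. part mu j < part la j}"
  have R1: "1 \<le> j \<and> j \<le> length la" if "j \<in> R" for j
    using that part_pos_iff[OF la, of j] by (auto simp: R_def)
  then have "finite R" by (meson finite_nat_set_iff_bounded_le)
  have "R \<noteq> {}"
  proof -
    have "D \<noteq> {}" using card \<open>t \<ge> 1\<close> by auto
    then obtain i c where "(i, c) \<in> D" by auto
    then show ?thesis unfolding R_def memD using less_le_trans by blast
  qed
  define p where "p = Min R"
  define q where "q = Max R"
  have pR: "p \<in> R" and qR: "q \<in> R" unfolding p_def q_def
    using \<open>finite R\<close> \<open>R \<noteq> {}\<close> by auto
  have pq: "p \<le> j \<and> j \<le> q" if "j \<in> R" for j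
    unfolding p_def q_def using that \<open>finite R\<close> by auto
  have shape: "Suc (part mu j) = part la (Suc j)" if j: "p \<le> j" "j < q" for j
  proof (rule antisym)
    show "Suc (part mu j) \<le> part la (Suc j)"
    proof (rule ccontr)
      assume "\<not> ?thesis"
      then have gap: "part la (Suc j) \<le> part mu j" by simp
      have "(p, part la p) \<in> D" "(q, part la q) \<in> D"
        using pR qR by (auto simp: memD R_def)
      then have "((p, part la p), (q, part la q)) \<in> {(x, y). x \<in> D \<and> y \<in> D \<and> box_adjacent x y}\<^sup>*"
        using conn unfolding boxes_connected_def by blast
      \<comment> \<open>Invariant along a path that starts in row p \<le> j: stepping from row j
        down to row j+1 would need a column c with mu_j < c \<le> la_(j+1), which \<open>gap\<close>
        rules out.\<close>
      then have "fst (q, part la q) \<le> j"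
      proof (induction rule: rtrancl_induct)
        case base
        then show ?case using j by simp
      next
        case (step y z)
        obtain i c i' c' where yz: "y = (i, c)" "z = (i', c')" by (cases y, cases z) auto
        have D: "(i, c) \<in> D" "(i', c') \<in> D" "box_adjacent (i, c) (i', c')" "i \<le> j"
          using step yz by auto
        show ?case
        proof (rule ccontr)
          assume "\<not> fst z \<le> j"
          then have "i = j" "i' = Suc j" "c' = c" using D yz by (auto simp: box_adjacent_def)
          then show False using D gap by (auto simp: memD)
        qed
      qed
      then show False using j by simp
    qed
    show "part la (Suc j) \<le> Suc (part mu j)"
    proof (rule ccontr)
      assume "\<not> ?thesis"
      then have wide: "Suc (Suc (part mu j)) \<le> part la (Suc j)" by simp
      have "1 \<le> j" using j R1[OF pR] by simp
      then have "part la (Suc j) \<le> part la j" "part mu (Suc j) \<le> part mu j"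
        using part_antimono la mu by auto
      \<comment> \<open>The block sits in the two leftmost columns shared by rows j and j+1.\<close>
      then have "{(j, Suc (part mu j)), (j + 1, Suc (part mu j)), (j, Suc (part mu j) + 1),
          (j + 1, Suc (part mu j) + 1)} \<subseteq> D"
        using wide by (auto simp: memD)
      then show False using no22 unfolding contains_2x2_def by blast
    qed
  qed
  have eq: "part mu j = part la j" if "j < p \<or> q < j" for j
  proof -
    have "j \<notin> R" using that pq[of j] by auto
    then show ?thesis using le[of j] by (simp add: R_def)
  qed
  have hs: "hook_shape la mu p q"
    unfolding hook_shape_def using shape eq qR R1[OF pR] pq[OF pR] by (auto simp: R_def)
  then show ?thesis using card_hook_shape[OF la hs] card unfolding D_def by fastforce
qed

lemma row_connected:
  assumes "\<And>d. c \<le> d \<Longrightarrow> d \<le> c' \<Longrightarrow> (i, d) \<in> D" "c \<le> c'"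
  shows "((i, c), (i, c')) \<in> {(x, y). x \<in> D \<and> y \<in> D \<and> box_adjacent x y}\<^sup>*"
  using assms(2,1)
proof (induction c' rule: dec_induct)
  case (step n)
  have "((i, n), (i, Suc n)) \<in> {(x, y). x \<in> D \<and> y \<in> D \<and> box_adjacent x y}"
    using step.hyps step.prems by (auto simp: box_adjacent_def)
  then show ?case using step by (meson le_SucI rtrancl.rtrancl_into_rtrancl)
qed simp

lemma hook_shape_imp_removes_rim_hook:
  assumes la: "is_partition la" and mu: "is_partition mu" and hs: "hook_shape la mu p q"
    and t: "part la p + q = part mu q + p + t"
  shows "removes_rim_hook t la mu"
proof -
  define D where "D = young_diagram la - young_diagram mu"
  define E where "E = {(x, y). x \<in> D \<and> y \<in> D \<and> box_adjacent x y}"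
  have memD: "(i, c) \<in> D \<longleftrightarrow> part mu i < c \<and> c \<le> part la i" for i c
    unfolding D_def mem_skew_diagram ..
  have rows: "p \<le> i \<and> i \<le> q" if "(i, c) \<in> D" for i c
    using that hs unfolding memD hook_shape_def by (metis leD leI le_less_trans)
  have lt: "part mu i < part la i" if "p \<le> i" "i \<le> q" for i
    using hook_shape_less[OF la hs] that .
  have shape: "Suc (part mu i) = part la (Suc i)" if "p \<le> i" "i < q" for i
    using hs that by (simp add: hook_shape_def)
  have "sym E" unfolding E_def sym_def box_adjacent_def by auto
  then have symE: "(y, x) \<in> E\<^sup>*" if "(x, y) \<in> E\<^sup>*" for x y
    using that by (meson symD sym_rtrancl)
  have row: "((i, c), (i, c')) \<in> E\<^sup>*" if D: "(i, c) \<in> D" "(i, c') \<in> D" for i c c'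
  proof (cases "c \<le> c'")
    case True
    then show ?thesis unfolding E_def by (intro row_connected) (use D memD in auto)
  next
    case False
    then have "((i, c'), (i, c)) \<in> E\<^sup>*"
      unfolding E_def by (intro row_connected) (use D memD in auto)
    then show ?thesis by (rule symE)
  qed
  \<comment> \<open>The last box of row q is a common target. Within row i one moves to column
    la_(i+1), the only column shared with the next row, and steps down there.\<close>
  have to_end: "\<forall>c. (i, c) \<in> D \<longrightarrow> ((i, c), (q, part la q)) \<in> E\<^sup>*" if "i \<le> q" "p \<le> i" for i
    using that
  proof (induction rule: inc_induct)
    case base
    then show ?case using row lt by (simp add: memD)
  next
    case (step i)
    have i: "(i, part la (Suc i)) \<in> D" "(Suc i, part la (Suc i)) \<in> D"
      using step shape[of i] lt[of i] lt[of "Suc i"] by (auto simp: memD)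
    then have "((i, part la (Suc i)), (Suc i, part la (Suc i))) \<in> E"
      by (auto simp: E_def box_adjacent_def)
    moreover have "((Suc i, part la (Suc i)), (q, part la q)) \<in> E\<^sup>*" using step i by simp
    ultimately show ?case using row i(1) by (meson converse_rtrancl_into_rtrancl rtrancl_trans)
  qed
  have "boxes_connected D"
    unfolding boxes_connected_def E_def[symmetric]
  proof (intro ballI)
    fix b c assume "b \<in> D" "c \<in> D"
    then have "(b, (q, part la q)) \<in> E\<^sup>*" "(c, (q, part la q)) \<in> E\<^sup>*"
      using to_end rows by (cases b, cases c, auto)+
    then show "(b, c) \<in> E\<^sup>*" using symE rtrancl_trans by metis
  qed
  moreover have "\<not> contains_2x2 D"
  proof
    assume "contains_2x2 D"
    \<comment> \<open>Two diagonal boxes suffice: mu_i < j and j + 1 \<le> la_(i+1) = mu_i + 1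
      contradict each other.\<close>
    then obtain i j where ij: "(i, j) \<in> D" "(Suc i, Suc j) \<in> D"
      unfolding contains_2x2_def by auto
    then show False using rows[OF ij(1)] rows[OF ij(2)] shape[of i] by (auto simp: memD)
  qed
  moreover have "card D = t" using card_hook_shape[OF la hs] t unfolding D_def by simp
  ultimately show ?thesis
    unfolding removes_rim_hook_def D_def young_diagram_subset_iff
    using la mu hook_shape_le[OF la hs] by blast
qed

section \<open>Partitions with at most N parts as N-element sets of naturals\<close>

section \<open>Beta sets\<close>

text \<open>N is a parameter rather than the length of the list, so that partitions of different
  lengths are compared in one encoding. For j \<le> N the subtraction does not truncate.\<close>

definition beta :: "nat \<Rightarrow> nat list \<Rightarrow> nat \<Rightarrow> nat" where
  "beta N la j = part la j + N - j"

definition beta_set :: "nat \<Rightarrow> nat list \<Rightarrow> nat set" where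
  "beta_set N la = beta N la ` {1..N}"

lemma beta_strict_antimono:
  assumes "is_partition la" "1 \<le> i" "i < j" "j \<le> N"
  shows "beta N la j < beta N la i"
  using part_antimono[OF assms(1), of i j] assms by (simp add: beta_def)

lemma inj_on_beta:
  assumes "is_partition la"
  shows "inj_on (beta N la) {1..N}"
proof (rule linorder_inj_onI)
  fix i j assume "i < j" "i \<in> {1..N}" "j \<in> {1..N}"
  then have "beta N la j < beta N la i" by (intro beta_strict_antimono[OF assms]) auto
  then show "beta N la i \<noteq> beta N la j" by simp
qed auto

lemma finite_beta_set [simp]: "finite (beta_set N la)"
  by (simp add: beta_set_def)

lemma card_beta_set: "is_partition la \<Longrightarrow> card (beta_set N la) = N"
  using card_image[OF inj_on_beta] by (simp add: beta_set_def)

text \<open>The beta numbers decrease strictly in j, so listing the set in increasing order reads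
  them off for j = N, ..., 1. The parts beyond N vanish by the length bounds.\<close>

lemma beta_set_inject:
  assumes la: "is_partition la" "length la \<le> N" and mu: "is_partition mu" "length mu \<le> N"
    and eq: "beta_set N la = beta_set N mu"
  shows "la = mu"
proof (rule partition_eqI[OF la(1) mu(1)])
  have sorted: "sorted_wrt (<) (map (beta N nu) (rev [1..<Suc N]))" if "is_partition nu" for nu
    unfolding sorted_wrt_map sorted_wrt_rev
    using beta_strict_antimono[OF that, of _ _ N]
    by (auto simp: sorted_wrt_iff_nth_less simp del: upt_Suc)
  have "set (map (beta N nu) (rev [1..<Suc N])) = beta_set N nu" for nu
    by (simp add: beta_set_def atLeastLessThanSuc_atLeastAtMost del: upt_Suc)
  then have "map (beta N la) (rev [1..<Suc N]) = map (beta N mu) (rev [1..<Suc N])"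
    using strict_sorted_equal[OF sorted sorted] la(1) mu(1) eq by metis
  then have beta: "beta N la j = beta N mu j" if "1 \<le> j" "j \<le> N" for j
    using that by (simp del: upt_Suc)
  fix j
  show "part la j = part mu j"
  proof (cases "1 \<le> j \<and> j \<le> N")
    case True
    then show ?thesis using beta[of j] unfolding beta_def by linarith
  next
    case False
    then show ?thesis using la mu by (auto simp: part_def)
  qed
qed

text \<open>If l enumerates Y increasingly from index 0, row j must have beta number l_(N-j), so its
  part is l_(N-j) - (N-j). Strict increase makes these parts weakly decreasing, and l_i \<ge> i
  keeps the subtraction from truncating.\<close>

lemma ex_partition_beta_set:
  assumes "finite Y" "card Y = N"
  shows "\<exists>la. is_partition la \<and> length la \<le> N \<and> beta_set N la = Y"
proof -
  define l where "l = sorted_list_of_set Y"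
  have l: "sorted_wrt (<) l" "set l = Y" "length l = N"
    unfolding l_def using assms by auto
  have mono: "l ! i < l ! j" if "i < j" "j < N" for i j
    using l that by (simp add: sorted_wrt_iff_nth_less)
  have ge: "i \<le> l ! i" if "i < N" for i
    using that
  proof (induction i)
    case (Suc i)
    then show ?case using mono[of i "Suc i"] by simp
  qed simp
  have step: "l ! (N - Suc j) - (N - Suc j) \<le> l ! (N - j) - (N - j)" if "1 \<le> j" "j < N" for j
    using mono[of "N - Suc j" "N - j"] that by linarith
  obtain la where la: "is_partition la" "length la \<le> N"
    "\<forall>j\<in>{1..N}. part la j = l ! (N - j) - (N - j)"
    using ex_partition[of N "\<lambda>j. l ! (N - j) - (N - j)"] step by blast
  have "beta N la j = l ! (N - j)" if "j \<in> {1..N}" for j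
    using la(3) ge[of "N - j"] that by (auto simp: beta_def)
  then have "beta_set N la = (\<lambda>j. l ! (N - j)) ` {1..N}"
    unfolding beta_set_def by (rule image_cong[OF refl])
  also have "\<dots> = (\<lambda>i. l ! i) ` ((\<lambda>j. N - j) ` {1..N})" by (simp add: image_image)
  also have "(\<lambda>j. N - j) ` {1..N} = {0..<N}"
  proof (intro set_eqI iffI)
    fix i assume "i \<in> {0..<N}"
    then show "i \<in> (\<lambda>j. N - j) ` {1..N}" by (intro image_eqI[of _ _ "N - i"]) auto
  qed auto
  also have "(\<lambda>i. l ! i) ` {0..<N} = Y" using l by (auto simp: set_conv_nth)
  finally show ?thesis using la by blast
qed

section \<open>Rim hook removals as slides of beta sets\<close>

lemma length_le_if_parts_le:
  assumes "is_partition la" "is_partition mu" "\<And>j. part mu j \<le> part la j"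
  shows "length mu \<le> length la"
proof (rule ccontr)
  assume "\<not> ?thesis"
  then have "part mu (length mu) > 0" "part la (length mu) = 0"
    using part_pos_iff[OF assms(2), of "length mu"] by (auto simp: part_def)
  then show False using assms(3)[of "length mu"] by simp
qed

text \<open>On an abacus with t runners, one bead moves to the free place next to it, one step
  towards the start of its runner.\<close>

definition slides :: "nat \<Rightarrow> nat set \<Rightarrow> nat set \<Rightarrow> bool" where
  "slides t X Y \<longleftrightarrow> (\<exists>x\<in>X. t \<le> x \<and> x - t \<notin> X \<and> Y = insert (x - t) (X - {x}))"

text \<open>Since mu_j + 1 = la_(j+1) inside the hook, the beta numbers of la in rows p+1, ..., q
  reappear in mu one row higher. Only that of row p is lost, and row q of mu receives a new one,
  smaller by the hook size t.\<close>

lemma removes_rim_hook_imp_slides: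
  assumes "t \<ge> 1" and rem: "removes_rim_hook t la mu" and len: "length la \<le> N"
  shows "length mu \<le> N \<and> slides t (beta_set N la) (beta_set N mu)"
proof -
  obtain p q where hs: "hook_shape la mu p q" and t: "part la p + q = part mu q + p + t"
    using removes_rim_hook_imp_hook_shape[OF assms(1,2)] by blast
  have la: "is_partition la" and mu: "is_partition mu"
    using rem by (auto simp: removes_rim_hook_def)
  have "part la q > 0" using hs by (auto simp: hook_shape_def)
  then have qN: "q \<le> N" using part_pos_iff[OF la, of q] len by simp
  have pq: "1 \<le> p" "p \<le> q" using hs by (auto simp: hook_shape_def)
  have out: "beta N mu j = beta N la j" if "j < p \<or> q < j" for j
    using hs that by (auto simp: hook_shape_def beta_def)
  have inside: "beta N mu j = beta N la (Suc j)" if "p \<le> j" "j < q" for j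
  proof -
    have "Suc (part mu j) = part la (Suc j)" using hs that by (simp add: hook_shape_def)
    then show ?thesis by (simp add: beta_def flip: \<open>Suc (part mu j) = part la (Suc j)\<close>)
  qed
  have "beta N mu ` {p..<q} = (\<lambda>j. beta N la (Suc j)) ` {p..<q}"
    by (rule image_cong) (auto simp: inside)
  also have "\<dots> = beta N la ` {Suc p..<Suc q}"
    by (metis image_Suc_atLeastLessThan image_image)
  finally have mid: "beta N mu ` {p..<q} = beta N la ` {Suc p..<Suc q}" .
  have ends: "beta N mu ` {1..<p} = beta N la ` {1..<p}"
    "beta N mu ` {Suc q..N} = beta N la ` {Suc q..N}"
    by (auto simp: out intro!: image_cong)
  \<comment> \<open>For mu the row set aside is q, which carries the new element; for la it is p,
    which carries the lost one. The remaining blocks match in order.\<close>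
  have split1: "{1..N} = {1..<p} \<union> {p..<q} \<union> {q} \<union> {Suc q..N}"
    and split2: "{1..N} - {p} = {1..<p} \<union> {Suc p..<Suc q} \<union> {Suc q..N}"
    using pq qN by auto
  have "beta_set N mu = beta N mu ` ({1..<p} \<union> {p..<q} \<union> {q} \<union> {Suc q..N})"
    unfolding beta_set_def by (rule arg_cong[OF split1])
  also have "\<dots> = insert (beta N mu q) (beta N la ` ({1..<p} \<union> {Suc p..<Suc q} \<union> {Suc q..N}))"
    by (simp only: image_Un mid ends) auto
  also have "{1..<p} \<union> {Suc p..<Suc q} \<union> {Suc q..N} = {1..N} - {p}" by (rule split2[symmetric])
  also have "beta N la ` ({1..N} - {p}) = beta_set N la - {beta N la p}"
    unfolding beta_set_def using inj_on_image_set_diff[OF inj_on_beta[OF la, of N], of "{1..N}" "{p}"] pq qN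
    by simp
  finally have Y: "beta_set N mu = insert (beta N mu q) (beta_set N la - {beta N la p})" .
  have bp: "beta N la p \<in> beta_set N la" using pq qN by (auto simp: beta_set_def)
  have y: "beta N mu q = beta N la p - t" "t \<le> beta N la p"
    using t pq qN by (auto simp: beta_def)
  (* Otherwise the beta set of mu would have fewer than N elements. *)
  have "beta N mu q \<notin> beta_set N la - {beta N la p}"
  proof
    assume "beta N mu q \<in> beta_set N la - {beta N la p}"
    then have "beta_set N mu = beta_set N la - {beta N la p}" using Y by auto
    then have "card (beta_set N mu) < card (beta_set N la)"
      using bp by (metis card_Diff1_less finite_beta_set)
    then show False using card_beta_set la mu by simp
  qed
  then have "beta N la p - t \<notin> beta_set N la" using y \<open>t \<ge> 1\<close> by auto
  then have "slides t (beta_set N la) (beta_set N mu)"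
    unfolding slides_def using bp y Y by auto
  moreover have "length mu \<le> N"
    using length_le_if_parts_le[OF la mu] hook_shape_le[OF la hs] len le_trans by blast
  ultimately show ?thesis by simp
qed

text \<open>The converse construction: x belongs to some row p, and the hook ends in the last row q
  whose beta number still exceeds x - t. There x - t fits into the decreasing order.\<close>

lemma ex_removes_rim_hook:
  assumes "t \<ge> 1" and la: "is_partition la" and x: "x \<in> beta_set N la" "t \<le> x" "x - t \<notin> beta_set N la"
    and len: "length la \<le> N"
  shows "\<exists>mu. removes_rim_hook t la mu"
proof -
  obtain p where p: "1 \<le> p" "p \<le> N" "x = beta N la p" using x(1) by (auto simp: beta_set_def)
  define y where "y = x - t"
  define S where "S = {j \<in> {1..N}. y < beta N la j}"
  define q where "q = Max S"
  have "finite S" "p \<in> S" unfolding S_def y_def using p x(2) \<open>t \<ge> 1\<close> by auto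
  have "q \<in> S" unfolding q_def using \<open>finite S\<close> \<open>p \<in> S\<close> by (intro Max_in) auto
  have pq: "p \<le> q" unfolding q_def using \<open>finite S\<close> \<open>p \<in> S\<close> by (rule Max_ge)
  from \<open>q \<in> S\<close> have qN: "q \<le> N" and yq: "y < beta N la q" by (auto simp: S_def)
  \<comment> \<open>The inequality is strict because y is not in the beta set.\<close>
  have after: "beta N la j < y" if "q < j" "j \<le> N" for j
  proof -
    have "j \<notin> S" using that Max_ge[OF \<open>finite S\<close>, of j] by (auto simp: q_def)
    then have "beta N la j \<le> y" using that by (auto simp: S_def)
    moreover have "beta N la j \<in> beta_set N la" using that by (auto simp: beta_set_def)
    ultimately show ?thesis using x(3) unfolding y_def by (metis le_neq_implies_less)
  qed
  have yge: "part la (Suc q) + N \<le> y + q"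
  \<comment> \<open>Row N+1 has no beta number, but its part is 0 by the length bound.\<close>
  proof (cases "q = N")
    case True
    then show ?thesis using len by (simp add: part_def)
  next
    case False
    then show ?thesis using after[of "Suc q"] qN by (simp add: beta_def)
  qed
  \<comment> \<open>With \<open>yge\<close> this gives la_(q+1) \<le> y + q - N < la_q, without
    truncation: the new part of row q fits.\<close>
  have ylt: "y + q < part la q + N" using yq qN by (simp add: beta_def)
  have pos: "part la j > 0" if "1 \<le> j" "j \<le> q" for j
    using part_antimono[OF la that] ylt yge by simp
  \<comment> \<open>In terms of beta numbers: x leaves row p, rows p+1, ..., q move up by one row,
    and y enters row q.\<close>
  define f where "f j = (if j < p \<or> q < j then part la j else if j < q then part la (Suc j) - 1
    else y + q - N)" for j
  have "f (Suc j) \<le> f j" if "1 \<le> j" "j < N" for j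
  proof -
    have *: "part la (Suc j) \<le> part la j" "part la (Suc (Suc j)) \<le> part la (Suc j)"
      using part_antimono[OF la] that by auto
    consider "Suc j < p \<or> q < j" | "Suc j = p" "p < q" | "Suc j = p" "p = q" | "p \<le> j" "Suc j < q"
      | "p \<le> j" "Suc j = q" | "j = q" by linarith
    then show ?thesis
    proof cases
      case 3
      then show ?thesis using * ylt pq by (auto simp: f_def)
    next
      case 5
      then show ?thesis using * ylt pq pos[of "Suc j"] by (auto simp: f_def)
    next
      case 6
      then show ?thesis using * yge pq by (auto simp: f_def)
    qed (use * pq in \<open>auto simp: f_def\<close>)
  qed
  then obtain mu where mu: "is_partition mu" "length mu \<le> N" "\<forall>j\<in>{1..N}. part mu j = f j"
    using ex_partition[of N f] by blast
  have "part mu j = part la j" if "j < p \<or> q < j" for j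
  proof (cases "j \<in> {1..N}")
    case True
    then show ?thesis using that mu(3) by (auto simp: f_def)
  next
    case False
    then show ?thesis using len mu(2) by (auto simp: part_def)
  qed
  moreover have "Suc (part mu j) = part la (Suc j)" if "p \<le> j" "j < q" for j
    using mu(3) that p qN pos[of "Suc j"] by (auto simp: f_def)
  moreover have muq: "part mu q = y + q - N"
    using mu(3) p pq qN by (auto simp: f_def)
  ultimately have hs: "hook_shape la mu p q"
    unfolding hook_shape_def using p pq yge ylt by auto
  moreover have "part la p + q = part mu q + p + t"
    using muq yge x(2) p(3) \<open>p \<le> N\<close> by (auto simp: y_def beta_def)
  ultimately show ?thesis using hook_shape_imp_removes_rim_hook[OF la mu(1)] by blast
qed

section \<open>Residue counts as invariants, and sets closed under subtracting t\<close>

section \<open>Cores and residue counts\<close>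

definition residue_count :: "nat \<Rightarrow> nat set \<Rightarrow> nat \<Rightarrow> nat" where
  "residue_count t X i = card {x \<in> X. x mod t = i}"

lemma residue_count_slides:
  assumes "finite X" "slides t X Y"
  shows "residue_count t Y i = residue_count t X i"
proof -
  obtain x where x: "x \<in> X" "t \<le> x" "x - t \<notin> X" "Y = insert (x - t) (X - {x})"
    using assms(2) by (auto simp: slides_def)
  let ?X = "{z \<in> X. z mod t = i}"
  have m: "(x - t) mod t = x mod t" using x(2) by (simp add: le_mod_geq)
  show ?thesis
  proof (cases "x mod t = i")
    case True
    then have "{z \<in> Y. z mod t = i} = insert (x - t) (?X - {x})" using x m by auto
    moreover have "card (insert (x - t) (?X - {x})) = Suc (card (?X - {x}))"
      using x(3) assms(1) by (intro card_insert_disjoint) auto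
    moreover have "Suc (card (?X - {x})) = card ?X"
      using x(1) True assms(1) by (intro card_Suc_Diff1) auto
    ultimately show ?thesis by (simp add: residue_count_def)
  next
    case False
    then have "{z \<in> Y. z mod t = i} = ?X" using x m by auto
    then show ?thesis by (simp add: residue_count_def)
  qed
qed

text \<open>The sum of the beta set serves as the measure showing that repeated removal
  terminates.\<close>

lemma slides_sum_less:
  assumes "finite X" "slides t X Y" "t \<ge> 1"
  shows "\<Sum>Y < \<Sum>X"
proof -
  obtain x where x: "x \<in> X" "t \<le> x" "x - t \<notin> X" "Y = insert (x - t) (X - {x})"
    using assms(2) by (auto simp: slides_def)
  then show ?thesis using assms sum.remove[OF assms(1) x(1), of "\<lambda>z. z"] by simp
qed

text \<open>Closure under subtracting t means that runner i has no gap below a bead, so its beads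
  fill an initial segment whose length is the residue count.\<close>

lemma flush_residue_class:
  assumes "finite X" "t \<ge> 1" "i < t" and flush: "\<And>x. x \<in> X \<Longrightarrow> t \<le> x \<Longrightarrow> x - t \<in> X"
  shows "{x \<in> X. x mod t = i} = (\<lambda>k. i + t * k) ` {..<residue_count t X i}"
proof -
  let ?K = "{k. i + t * k \<in> X}"
  have inj: "inj (\<lambda>k. i + t * k)" using \<open>t \<ge> 1\<close> by (auto simp: inj_def)
  have img: "{x \<in> X. x mod t = i} = (\<lambda>k. i + t * k) ` ?K"
  proof (intro set_eqI iffI)
    fix x assume x: "x \<in> {x \<in> X. x mod t = i}"
    then have "x = i + t * (x div t)" by (metis (mono_tags) add.commute mem_Collect_eq mult_div_mod_eq)
    then show "x \<in> (\<lambda>k. i + t * k) ` ?K" using x by (metis (mono_tags, lifting) image_eqI mem_Collect_eq)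
  qed (use \<open>i < t\<close> in auto)
  have fin: "finite ?K" using finite_vimageI[OF assms(1) inj] by (simp add: vimage_def)
  have down: "k \<in> ?K" if "Suc k \<in> ?K" for k
    using flush[of "i + t * Suc k"] that by (simp add: algebra_simps)
  have "k \<in> ?K" if "k \<le> m" "m \<in> ?K" for k m
    using that
  proof (induction m rule: dec_induct)
    case (step n)
    then show ?case using down by blast
  qed
  then have closed: "k \<in> ?K" if "k \<le> m" "m \<in> ?K" for k m
    using that by blast
  \<comment> \<open>The first free place on the runner; it exists because X is finite.\<close>
  define m where "m = (LEAST m. m \<notin> ?K)"
  have "\<exists>m. m \<notin> ?K" using fin ex_new_if_finite infinite_UNIV_nat by blast
  then have m: "m \<notin> ?K" unfolding m_def by (rule LeastI_ex)
  have "?K = {..<m}"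
  proof (intro set_eqI iffI)
    fix k assume "k \<in> ?K"
    then have "\<not> m \<le> k" using closed m by blast
    then show "k \<in> {..<m}" by simp
  next
    fix k assume "k \<in> {..<m}"
    then show "k \<in> ?K" using not_less_Least[of k "\<lambda>m. m \<notin> ?K"] unfolding m_def by blast
  qed
  then have "?K = {..<card ?K}" by simp
  moreover have "card ?K = residue_count t X i"
    unfolding residue_count_def img using card_image[OF inj_on_subset[OF inj subset_UNIV]] by metis
  ultimately show ?thesis using img by simp
qed

lemma flush_eqI:
  assumes "finite X" "finite Y" "t \<ge> 1"
    and "\<And>x. x \<in> X \<Longrightarrow> t \<le> x \<Longrightarrow> x - t \<in> X" "\<And>x. x \<in> Y \<Longrightarrow> t \<le> x \<Longrightarrow> x - t \<in> Y"
    and "\<And>i. i < t \<Longrightarrow> residue_count t X i = residue_count t Y i"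
  shows "X = Y"
proof -
  have "{x \<in> X. x mod t = i} = {x \<in> Y. x mod t = i}" if "i < t" for i
    using flush_residue_class[of X t i] flush_residue_class[of Y t i] assms that by simp
  moreover have "x mod t < t" for x using \<open>t \<ge> 1\<close> by simp
  ultimately show ?thesis by blast
qed

section \<open>Existence, uniqueness and classification of cores\<close>

lemma rim_hook_steps:
  assumes "(removes_rim_hook t)\<^sup>*\<^sup>* la mu" "t \<ge> 1" "is_partition la" "length la \<le> N"
  shows "is_partition mu \<and> length mu \<le> N \<and>
    (\<forall>i. residue_count t (beta_set N mu) i = residue_count t (beta_set N la) i)"
  using assms(1)
proof (induction rule: rtranclp_induct)
  case (step y z)
  then have "length z \<le> N \<and> slides t (beta_set N y) (beta_set N z)"
    using removes_rim_hook_imp_slides assms(2) by blast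
  then show ?case using step residue_count_slides[OF finite_beta_set, of t N y]
    by (auto simp: removes_rim_hook_def)
qed (use assms in simp)

lemma ex_irreducible:
  assumes "t \<ge> 1" "is_partition la"
  shows "\<exists>mu. (removes_rim_hook t)\<^sup>*\<^sup>* la mu \<and> (\<nexists>nu. removes_rim_hook t mu nu)"
proof -
  \<comment> \<open>N is frozen before the induction, since the sums of successive beta sets are
    comparable only for a common N.\<close>
  define N where "N = length la"
  have "\<exists>mu. (removes_rim_hook t)\<^sup>*\<^sup>* la mu \<and> (\<nexists>nu. removes_rim_hook t mu nu)" if "length la \<le> N"
    using that
  proof (induction "\<Sum>(beta_set N la)" arbitrary: la rule: less_induct)
    case less
    show ?case
    proof (cases "\<exists>nu. removes_rim_hook t la nu")
      case True
      then obtain nu where nu: "removes_rim_hook t la nu" by blast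
      then have "length nu \<le> N" "slides t (beta_set N la) (beta_set N nu)"
        using removes_rim_hook_imp_slides[OF \<open>t \<ge> 1\<close> nu less.prems] by auto
      then obtain mu where "(removes_rim_hook t)\<^sup>*\<^sup>* nu mu" "\<nexists>nu. removes_rim_hook t mu nu"
        using less.hyps[of nu] slides_sum_less[OF finite_beta_set _ \<open>t \<ge> 1\<close>] by blast
      then show ?thesis using nu by (meson converse_rtranclp_into_rtranclp)
    qed blast
  qed
  then show ?thesis by (simp add: N_def)
qed

text \<open>By \<open>ex_removes_rim_hook\<close>, if no hook can be removed then the beta set is
  closed under subtracting t, so \<open>flush_eqI\<close> applies.\<close>

lemma irreducible_eqI:
  assumes t: "t \<ge> 1" and la: "is_partition la" "length la \<le> N" and mu: "is_partition mu" "length mu \<le> N"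
    and irr: "\<nexists>nu. removes_rim_hook t la nu" "\<nexists>nu. removes_rim_hook t mu nu"
    and eq: "\<And>i. i < t \<Longrightarrow> residue_count t (beta_set N la) i = residue_count t (beta_set N mu) i"
  shows "la = mu"
proof (rule beta_set_inject[OF la mu])
  show "beta_set N la = beta_set N mu"
    using ex_removes_rim_hook[OF t la(1) _ _ _ la(2)] ex_removes_rim_hook[OF t mu(1) _ _ _ mu(2)]
      irr eq t by (intro flush_eqI[of _ _ t]) auto
qed

text \<open>This unfolds the definite description. Two end results of removal from la both have the
  residue counts of la, so \<open>irreducible_eqI\<close> identifies them.\<close>

lemma t_core_of_eq_iff:
  assumes t: "t \<ge> 1" and la: "is_partition la"
  shows "t_core_of t la = mu \<longleftrightarrow>
    (removes_rim_hook t)\<^sup>*\<^sup>* la mu \<and> (\<nexists>nu. removes_rim_hook t mu nu)"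
proof -
  have "\<exists>!mu. (removes_rim_hook t)\<^sup>*\<^sup>* la mu \<and> (\<nexists>nu. removes_rim_hook t mu nu)"
  proof (rule ex_ex1I[OF ex_irreducible[OF assms]])
    fix mu mu'
    assume *: "(removes_rim_hook t)\<^sup>*\<^sup>* la mu \<and> (\<nexists>nu. removes_rim_hook t mu nu)"
      "(removes_rim_hook t)\<^sup>*\<^sup>* la mu' \<and> (\<nexists>nu. removes_rim_hook t mu' nu)"
    show "mu = mu'"
      using rim_hook_steps[of t la mu "length la"] rim_hook_steps[of t la mu' "length la"] * t la
      by (intro irreducible_eqI[of t mu "length la" mu']) auto
  qed
  from the1_equality[OF this] theI'[OF this] show ?thesis
    unfolding t_core_of_def by blast
qed

text \<open>For the converse direction, the core of la is irreducible and inherits the residue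
  counts of la, which are those of rho; and rho is irreducible, being its own core.\<close>

lemma t_core_of_eq_core_iff:
  assumes t: "t \<ge> 1" and la: "is_partition la" "length la \<le> N"
    and rho: "is_partition rho" "length rho \<le> N" "is_t_core t rho"
  shows "t_core_of t la = rho \<longleftrightarrow>
    (\<forall>i<t. residue_count t (beta_set N la) i = residue_count t (beta_set N rho) i)"
proof
  assume "t_core_of t la = rho"
  then show "\<forall>i<t. residue_count t (beta_set N la) i = residue_count t (beta_set N rho) i"
    using rim_hook_steps[of t la rho N] t la t_core_of_eq_iff[OF t la(1)] by auto
next
  assume eq: "\<forall>i<t. residue_count t (beta_set N la) i = residue_count t (beta_set N rho) i"
  define mu where "mu = t_core_of t la"
  then have mu: "(removes_rim_hook t)\<^sup>*\<^sup>* la mu" "\<nexists>nu. removes_rim_hook t mu nu"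
    using t_core_of_eq_iff[OF t la(1)] by blast+
  moreover have "\<nexists>nu. removes_rim_hook t rho nu"
    using rho t_core_of_eq_iff[OF t rho(1)] by (auto simp: is_t_core_def)
  ultimately have "mu = rho"
    using rim_hook_steps[OF mu(1) t la] eq t rho by (intro irreducible_eqI[of t mu N rho]) auto
  then show "t_core_of t la = rho" by (simp add: mu_def)
qed

section \<open>Subsets of an initial segment with prescribed residue counts\<close>

section \<open>Counting\<close>

text \<open>The quotient is (M - i)/t rounded up, the number of k with i + t * k < M. For M = r + s
  it is \<open>runner_length r s t i\<close>.\<close>

lemma residue_class_lessThan:
  fixes M :: nat
  assumes "i < t"
  shows "{x. x < M \<and> x mod t = i} = (\<lambda>k. i + t * k) ` {..<(M + t - 1 - i) div t}"
proof -
  have lt: "k < (M + t - 1 - i) div t \<longleftrightarrow> i + t * k < M" for k :: nat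
  proof -
    have "k < (M + t - 1 - i) div t \<longleftrightarrow> Suc k * t \<le> M + t - 1 - i"
      using assms by (simp add: less_eq_div_iff_mult_less_eq flip: Suc_le_eq)
    also have "\<dots> \<longleftrightarrow> i + t * k < M" using assms by (auto simp: algebra_simps)
    finally show ?thesis .
  qed
  show ?thesis
  proof (intro set_eqI iffI)
    fix x assume x: "x \<in> {x. x < M \<and> x mod t = i}"
    then have "x = i + t * (x div t)" by (metis (mono_tags) add.commute mem_Collect_eq mult_div_mod_eq)
    then show "x \<in> (\<lambda>k. i + t * k) ` {..<(M + t - 1 - i) div t}"
      using x lt[of "x div t"] by auto
  next
    fix x assume "x \<in> (\<lambda>k. i + t * k) ` {..<(M + t - 1 - i) div t}"
    then obtain k where "x = i + t * k" "k < (M + t - 1 - i) div t" by blast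
    then show "x \<in> {x. x < M \<and> x mod t = i}" unfolding lt using assms by simp
  qed
qed

text \<open>A set amounts to the tuple of its residue classes, with union as inverse, and the
  classes are chosen independently. Tuples are extensional functions on {..<t}, so
  \<open>card_PiE\<close> yields the product.\<close>

lemma card_sets_with_residue_counts:
  assumes "t \<ge> 1"
  shows "card {Y. Y \<subseteq> {..<M} \<and> (\<forall>i<t. residue_count t Y i = a i)} =
    (\<Prod>i<t. card {x. x < M \<and> x mod t = i} choose a i)"
proof -
  define C where "C i = {x. x < M \<and> x mod t = i}" for i
  have finC: "finite (C i)" for i by (simp add: C_def)
  define F where "F = (\<Pi>\<^sub>E i\<in>{..<t}. {A. A \<subseteq> C i \<and> card A = a i})"
  let ?S = "{Y. Y \<subseteq> {..<M} \<and> (\<forall>i<t. residue_count t Y i = a i)}"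
  let ?f = "\<lambda>Y. \<lambda>i\<in>{..<t}. {x \<in> Y. x mod t = i}"
  have modt: "x mod t < t" for x using \<open>t \<ge> 1\<close> by simp
  have "bij_betw ?f ?S F"
  proof (rule bij_betw_byWitness[where f' = "\<lambda>g. \<Union>i<t. g i"])
    show "\<forall>Y\<in>?S. (\<Union>i<t. ?f Y i) = Y" using modt by auto
    show "\<forall>g\<in>F. ?f (\<Union>i<t. g i) = g"
    proof (intro ballI ext)
      fix g i assume g: "g \<in> F"
      have sub: "g j \<subseteq> C j" if "j < t" for j using g that by (auto simp: F_def PiE_def)
      show "?f (\<Union>i<t. g i) i = g i"
      proof (cases "i < t")
        case True
        then show ?thesis using sub by (fastforce simp: C_def)
      next
        case False
        then show ?thesis using g by (auto simp: F_def PiE_def extensional_def)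
      qed
    qed
    show "?f ` ?S \<subseteq> F"
      unfolding F_def C_def residue_count_def by (auto intro!: PiE_I)
    show "(\<lambda>g. \<Union>i<t. g i) ` F \<subseteq> ?S"
    proof clarify
      fix g assume g: "g \<in> F"
      have sub: "g j \<subseteq> C j \<and> card (g j) = a j" if "j < t" for j
        using g that by (auto simp: F_def PiE_def)
      have "{x \<in> (\<Union>i<t. g i). x mod t = i} = g i" if "i < t" for i
        using sub that by (fastforce simp: C_def)
      then have "\<forall>i<t. residue_count t (\<Union>i<t. g i) i = a i"
        using sub by (simp add: residue_count_def)
      moreover have "(\<Union>i<t. g i) \<subseteq> {..<M}" using sub by (fastforce simp: C_def)
      ultimately show "(\<Union>i<t. g i) \<subseteq> {..<M} \<and> (\<forall>i<t. residue_count t (\<Union>i<t. g i) i = a i)" by blast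
    qed
  qed
  then have "card ?S = card F" by (rule bij_betw_same_card)
  also have "\<dots> = (\<Prod>i<t. card (C i) choose a i)"
    unfolding F_def by (simp add: card_PiE n_subsets[OF finC])
  finally show ?thesis by (simp add: C_def)
qed

text \<open>Hence prescribed residue counts already fix the cardinality, as is needed to recognise a
  set as a beta set.\<close>

lemma card_eq_sum_residue_count:
  assumes "finite X" "t \<ge> 1"
  shows "card X = (\<Sum>i<t. residue_count t X i)"
proof -
  have "card X = card (\<Union>i<t. {x \<in> X. x mod t = i})"
    by (rule arg_cong[of _ _ card]) (use \<open>t \<ge> 1\<close> in auto)
  also have "\<dots> = (\<Sum>i<t. residue_count t X i)"
    unfolding residue_count_def by (rule card_UN_disjoint) (use assms in auto)
  finally show ?thesis .
qed

section \<open>Abacus words, the bounding box and the final count\<close>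

lemma balanced_abacus_beta_set:
  assumes "length la \<le> r"
  shows "balanced_abacus la (- int r + int x) = (if x \<in> beta_set r la then 1 else 0)"
proof -
  have "(\<exists>j\<ge>1. - int r + int x = int (part la j) - int j) \<longleftrightarrow> x \<in> beta_set r la"
  proof
    assume "\<exists>j\<ge>1. - int r + int x = int (part la j) - int j"
    then obtain j where j: "j \<ge> 1" "- int r + int x = int (part la j) - int j" by blast
    \<comment> \<open>Rows beyond r are empty and give the positions -j < -r, to the left of where
      reading starts.\<close>
    have "j \<le> r"
    proof (rule ccontr)
      assume "\<not> j \<le> r"
      then have "part la j = 0" using assms by (simp add: part_def)
      then show False using j \<open>\<not> j \<le> r\<close> by simp
    qed
    moreover have "x = beta r la j" using j \<open>j \<le> r\<close> unfolding beta_def by linarith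
    ultimately show "x \<in> beta_set r la" using j by (auto simp: beta_set_def)
  next
    assume "x \<in> beta_set r la"
    then obtain j where j: "1 \<le> j" "j \<le> r" "x = beta r la j" by (auto simp: beta_set_def)
    then have "- int r + int x = int (part la j) - int j" unfolding beta_def by linarith
    then show "\<exists>j\<ge>1. - int r + int x = int (part la j) - int j" using j by blast
  qed
  then show ?thesis by (simp add: balanced_abacus_def)
qed

text \<open>The largest beta number is that of row 1, namely la_1 + r - 1, and it is below r + s
  exactly when la_1 \<le> s.\<close>

lemma in_box_iff:
  assumes "r \<ge> 1"
  shows "la \<in> partitions_in_box r s \<longleftrightarrow>
    is_partition la \<and> length la \<le> r \<and> beta_set r la \<subseteq> {..<r + s}"
proof (cases "is_partition la \<and> length la \<le> r")
  case True
  have "part la 1 \<le> s \<longleftrightarrow> beta_set r la \<subseteq> {..<r + s}"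
  proof
    assume *: "part la 1 \<le> s"
    have "beta r la j < r + s" if "1 \<le> j" "j \<le> r" for j
      using part_antimono[of la 1 j] True * that by (auto simp: beta_def)
    then show "beta_set r la \<subseteq> {..<r + s}" by (auto simp: beta_set_def)
  next
    assume "beta_set r la \<subseteq> {..<r + s}"
    moreover have "beta r la 1 \<in> beta_set r la"
      unfolding beta_set_def using assms by (intro imageI) simp
    ultimately have "beta r la 1 < r + s" by blast
    then show "part la 1 \<le> s" using assms by (simp add: beta_def)
  qed
  then show ?thesis using True by (simp add: partitions_in_box_def)
qed (auto simp: partitions_in_box_def)

text \<open>The word of runner i reads every place of residue i below r + s. Since rho lies in the
  box, no element of its beta set is missed.\<close>

lemma num_ones_runner_word:
  assumes "rho \<in> partitions_in_box r s" "r \<ge> 1" "i < t"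
  shows "num_ones (runner_word r s t rho i) = residue_count t (beta_set r rho) i"
proof -
  let ?X = "beta_set r rho"
  let ?n = "(r + s + t - 1 - i) div t"
  have len: "length rho \<le> r" and sub: "?X \<subseteq> {..<r + s}"
    using assms in_box_iff by auto
  have abacus: "balanced_abacus rho (- int r + int i + int t * int k) = (if i + t * k \<in> ?X then 1 else 0)" for k
    using balanced_abacus_beta_set[OF len, of "i + t * k"] by (simp add: algebra_simps)
  have count: "count_list (map (\<lambda>k. if P k then 1 else 0) ks) (1 :: nat) = length (filter P ks)"
    for P and ks :: "nat list"
    by (induction ks) auto
  have "num_ones (runner_word r s t rho i) = length (filter (\<lambda>k. i + t * k \<in> ?X) [0..<?n])"
    unfolding num_ones_def runner_word_def runner_length_def abacus by (rule count)
  also have "\<dots> = card {k. k < ?n \<and> i + t * k \<in> ?X}"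
    by (subst distinct_card[symmetric]) (auto intro!: arg_cong[of _ _ card])
  also have "\<dots> = card ((\<lambda>k. i + t * k) ` {k. k < ?n \<and> i + t * k \<in> ?X})"
    by (rule card_image[symmetric]) (use \<open>i < t\<close> in \<open>auto simp: inj_on_def\<close>)
  also have "(\<lambda>k. i + t * k) ` {k. k < ?n \<and> i + t * k \<in> ?X} = ?X \<inter> {x. x < r + s \<and> x mod t = i}"
    using residue_class_lessThan[of i t "r + s"] assms by auto
  also have "\<dots> = {x \<in> ?X. x mod t = i}" using sub by auto
  finally show ?thesis by (simp add: residue_count_def)
qed

theorem corollary4p3:
  fixes r s t :: nat and rho :: "nat list"
  assumes "r \<ge> 1" and "s \<ge> 1" and "t \<ge> 2"
    and "rho \<in> partitions_in_box r s" and "is_t_core t rho"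
  shows "card (box_partitions_with_core r s t rho) =
    (\<Prod>i = 0..t - 1. runner_length r s t i choose num_ones (runner_word r s t rho i))"
proof -
  define a where "a = residue_count t (beta_set r rho)"
  let ?S = "{Y. Y \<subseteq> {..<r + s} \<and> (\<forall>i<t. residue_count t Y i = a i)}"
  have t: "t \<ge> 1" using assms by simp
  have rho: "is_partition rho" "length rho \<le> r" using assms in_box_iff by auto
  have mem: "la \<in> box_partitions_with_core r s t rho \<longleftrightarrow>
      is_partition la \<and> length la \<le> r \<and> beta_set r la \<in> ?S" for la
  proof (cases "is_partition la \<and> length la \<le> r")
    case True
    then show ?thesis
      using t_core_of_eq_core_iff[OF t _ _ rho assms(5), of la]
      by (simp add: box_partitions_with_core_def a_def in_box_iff[OF \<open>r \<ge> 1\<close>])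
  qed (auto simp: box_partitions_with_core_def in_box_iff[OF \<open>r \<ge> 1\<close>])
  have "inj_on (beta_set r) (box_partitions_with_core r s t rho)"
    by (rule inj_onI) (use mem beta_set_inject in blast)
  \<comment> \<open>For surjectivity, Y has the residue counts of rho and hence exactly r elements,
    so it is the beta set of a partition with at most r parts.\<close>
  moreover have "beta_set r ` box_partitions_with_core r s t rho = ?S"
  proof (intro set_eqI iffI)
    fix Y assume Y: "Y \<in> ?S"
    then have "finite Y" using finite_subset by blast
    moreover have "card Y = r"
      using Y card_eq_sum_residue_count[OF \<open>finite Y\<close> t] card_beta_set[OF rho(1), of r]
        card_eq_sum_residue_count[OF finite_beta_set[of r rho] t] by (simp add: a_def)
    ultimately obtain la where "is_partition la" "length la \<le> r" "beta_set r la = Y"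
      using ex_partition_beta_set by blast
    then show "Y \<in> beta_set r ` box_partitions_with_core r s t rho" using mem Y by blast
  qed (use mem in blast)
  ultimately have "card (box_partitions_with_core r s t rho) = card ?S"
    by (metis card_image)
  also have "\<dots> = (\<Prod>i<t. card {x. x < r + s \<and> x mod t = i} choose a i)"
    by (rule card_sets_with_residue_counts[OF t])
  also have "\<dots> = (\<Prod>i<t. runner_length r s t i choose num_ones (runner_word r s t rho i))"
  proof (rule prod.cong)
    fix i assume "i \<in> {..<t}"
    then have i: "i < t" by simp
    have "card {x. x < r + s \<and> x mod t = i} = runner_length r s t i"
      using residue_class_lessThan[OF i, of "r + s"] assms i
      by (simp add: card_image inj_on_def runner_length_def)
    then show "card {x. x < r + s \<and> x mod t = i} choose a i =
        runner_length r s t i choose num_ones (runner_word r s t rho i)"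
      using num_ones_runner_word[OF assms(4,1) i] by (simp add: a_def)
  qed simp
  also have "{..<t} = {0..t - 1}" using t by auto
  finally show ?thesis .
qed

end
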